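(* Let $m\ge1$. For $\ell=1,\dots,m$ let $\mathbf f_{\ell}$ be an $r_\ell\times r_\ell$ matrix-valued trigonometric polynomial in one variable with $\mathbf f_\ell\ge0$, such that exactly one eigenvalue function $\lambda_{\bar\jmath}(\mathbf f_\ell)$ of $\mathbf f_\ell$ vanishes, exactly at one point $\theta_0^{(\ell)}\in[0,2\pi)$, all eigenvalues of $\mathbf f_\ell$ being positive otherwise; and let $\mathbf p_{r_\ell}$ be an $r_\ell\times r_\ell$ matrix-valued trigonometric polynomial satisfying, with $\mathrm q_{r_\ell}$ an eigenvector of $\mathbf f_\ell(\theta_0^{(\ell)})$ for the eigenvalue $0$: (i) $\mathbf p_{r_\ell}(\theta)^H\mathbf p_{r_\ell}(\theta)+\mathbf p_{r_\ell}(\theta+\pi)^H\mathbf p_{r_\ell}(\theta+\pi)>0$ for all $\theta\in[0,2\pi)$; (ii) $\mathbf s_{r_\ell}(\theta_0^{(\ell)})\,\mathrm q_{r_\ell}=\mathrm q_{r_\ell}$, where $\mathbf s_{r_\ell}(\theta)=\mathbf p_{r_\ell}(\theta)\left(\mathbf p_{r_\ell}(\theta)^H\mathbf p_{r_\ell}(\theta)+\mathbf p_{r_\ell}(\theta+\pi)^H\mathbf p_{r_\ell}(\theta+\pi)\right)^{-1}\mathbf p_{r_\ell}(\theta)^H$; (iii) $\lim_{\theta\to\theta_0^{(\ell)}}\lambda_{\bar\jmath}(\mathbf f_\ell(\theta))^{-1}\left(1-\lambda_{\bar\jmath}(\mathbf s_{r_\ell}(\theta))\right)=c_\ell$ for some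 $c_\ell\in\mathbb R$. Let $\mathbf p^{(m)}_{\mathbf r}(\theta_1,\dots,\theta_m)=\bigotimes_{\ell=1}^m\mathbf p_{r_\ell}(\theta_\ell)$, $$\mathbf s(\boldsymbol\theta)=\mathbf p^{(m)}_{\mathbf r}(\boldsymbol\theta)\left(\sum_{\xi\in\Omega(\boldsymbol\theta)}\mathbf p^{(m)}_{\mathbf r}(\xi)^H\mathbf p^{(m)}_{\mathbf r}(\xi)\right)^{-1}\mathbf p^{(m)}_{\mathbf r}(\boldsymbol\theta)^H,$$ $q_{\mathbf r}=\bigotimes_{\ell=1}^m\mathrm q_{r_\ell}$ and $\boldsymbol\theta_0=(\theta_0^{(1)},\dots,\theta_0^{(m)})$. Then $$\mathbf s(\boldsymbol\theta_0)\,q_{\mathbf r}=q_{\mathbf r}.$$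
   Context: $\otimes$ is the Kronecker product, $X^H$ the conjugate transpose; $X\ge0$ (resp. $X>0$) means $X$ is Hermitian nonnegative (resp. positive) definite. For $\boldsymbol\theta=(\theta_1,\dots,\theta_m)$, $\Omega(\boldsymbol\theta)=\{\boldsymbol\theta+\pi\boldsymbol\eta:\ \boldsymbol\eta\in\{0,1\}^m\}$. $\lambda_{\bar\jmath}(\mathbf s_{r_\ell}(\theta))$ denotes the continuous eigenvalue function of the Hermitian matrix-valued function $\mathbf s_{r_\ell}$ whose continuous eigenvector tends to $\mathrm q_{r_\ell}$ (up to normalization) as $\theta\to\theta_0^{(\ell)}$. *)

theory Defs
  imports
    Complex_Main
    "HOL-Library.FuncSet"
    "Jordan_Normal_Form.Gauss_Jordan_Elimination"
    "Jordan_Normal_Form.Schur_Decomposition"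
begin

section \<open>Hermitian nonnegative and positive definite matrices\<close>

text \<open>\<open>(A *\<^sub>v x) \<bullet>c x\<close> is \<open>x\<^sup>H A x\<close>, which is real for Hermitian \<open>A\<close>.\<close>

definition hermitian_mat :: "nat \<Rightarrow> complex mat \<Rightarrow> bool" where
  "hermitian_mat n A \<longleftrightarrow> A \<in> carrier_mat n n \<and> mat_adjoint A = A"

definition nonneg_definite :: "nat \<Rightarrow> complex mat \<Rightarrow> bool" where
  "nonneg_definite n A \<longleftrightarrow>
     hermitian_mat n A \<and> (\<forall>x\<in>carrier_vec n. 0 \<le> Re ((A *\<^sub>v x) \<bullet>c x))"

definition pos_definite :: "nat \<Rightarrow> complex mat \<Rightarrow> bool" where
  "pos_definite n A \<longleftrightarrow>
     hermitian_mat n A \<and> (\<forall>x\<in>carrier_vec n. x \<noteq> 0\<^sub>v n \<longrightarrow> 0 < Re ((A *\<^sub>v x) \<bullet>c x))"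

text \<open>Only meaningful for invertible matrices: \<^const>\<open>mat_inverse\<close> is \<^const>\<open>None\<close> on singular ones.\<close>

abbreviation mat_inv :: "complex mat \<Rightarrow> complex mat" where
  "mat_inv A \<equiv> the (mat_inverse A)"


section \<open>Matrix-valued trigonometric polynomials and their eigenvalue functions\<close>

definition trig_poly_mat :: "nat \<Rightarrow> (real \<Rightarrow> complex mat) \<Rightarrow> bool" where
  "trig_poly_mat r F \<longleftrightarrow>
     (\<exists>(d::nat) (A :: int \<Rightarrow> complex mat).
        (\<forall>k. A k \<in> carrier_mat r r) \<and>
        (\<forall>\<theta>. F \<theta> = mat r r (\<lambda>(i, j).
            \<Sum>k = - int d..int d. A k $$ (i, j) * cis (of_int k * \<theta>))))"

text \<open>
  \<open>lam 0, \<dots>, lam (r - 1)\<close> are continuous functions on the real line which at every \<open>\<theta>\<close>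
  enumerate the spectrum of \<open>F \<theta>\<close> with multiplicity. They need not be \<open>2\<pi>\<close>-periodic
  individually, so that analytic branches, which may be permuted by the period, are allowed.
\<close>

definition eigenvalue_functions ::
  "nat \<Rightarrow> (real \<Rightarrow> complex mat) \<Rightarrow> (nat \<Rightarrow> real \<Rightarrow> real) \<Rightarrow> bool" where
  "eigenvalue_functions r F lam \<longleftrightarrow>
     (\<forall>j<r. continuous_on UNIV (lam j)) \<and>
     (\<forall>\<theta>. char_poly (F \<theta>) = (\<Prod>j<r. [:- complex_of_real (lam j \<theta>), 1:]))"

text \<open>
  The factor \<open>a\<close> accounts for the eigenvector tending to \<open>q\<close> only up to normalization, and
  \<open>v \<theta> \<noteq> 0\<close> is part of \<^const>\<open>eigenvector\<close>. Since \<open>\<mu>\<close> is continuous on the whole line, it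
  belongs to some enumeration in the sense of \<^const>\<open>eigenvalue_functions\<close>.
\<close>

definition eigenvalue_function_towards ::
  "nat \<Rightarrow> (real \<Rightarrow> complex mat) \<Rightarrow> real \<Rightarrow> complex vec \<Rightarrow> (real \<Rightarrow> real) \<Rightarrow> bool" where
  "eigenvalue_function_towards r S \<theta>\<^sub>0 q \<mu> \<longleftrightarrow>
     continuous_on UNIV \<mu> \<and>
     (\<exists>(v :: real \<Rightarrow> complex vec) (a :: complex). a \<noteq> 0 \<and>
        (\<forall>\<theta>. eigenvector (S \<theta>) (v \<theta>) (complex_of_real (\<mu> \<theta>))) \<and>
        (\<forall>i<r. continuous_on UNIV (\<lambda>\<theta>. v \<theta> $ i) \<and>
               ((\<lambda>\<theta>. v \<theta> $ i) \<longlongrightarrow> a * q $ i) (at \<theta>\<^sub>0)))"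


section \<open>Kronecker products\<close>

definition kron :: "complex mat \<Rightarrow> complex mat \<Rightarrow> complex mat" where
  "kron A B = mat (dim_row A * dim_row B) (dim_col A * dim_col B)
     (\<lambda>(i, j). A $$ (i div dim_row B, j div dim_col B) * B $$ (i mod dim_row B, j mod dim_col B))"

definition kron_vec :: "complex vec \<Rightarrow> complex vec \<Rightarrow> complex vec" where
  "kron_vec u v = vec (dim_vec u * dim_vec v)
     (\<lambda>i. u $ (i div dim_vec v) * v $ (i mod dim_vec v))"

text \<open>\<open>big_kron m A\<close> is \<open>A 0 \<otimes> \<dots> \<otimes> A (m - 1)\<close>; the factors are numbered from \<open>0\<close>.\<close>

primrec big_kron :: "nat \<Rightarrow> (nat \<Rightarrow> complex mat) \<Rightarrow> complex mat" where
  "big_kron 0 A = 1\<^sub>m 1"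
| "big_kron (Suc m) A = kron (big_kron m A) (A m)"

primrec big_kron_vec :: "nat \<Rightarrow> (nat \<Rightarrow> complex vec) \<Rightarrow> complex vec" where
  "big_kron_vec 0 v = vec 1 (\<lambda>_. 1)"
| "big_kron_vec (Suc m) v = kron_vec (big_kron_vec m v) (v m)"


section \<open>The projector symbols\<close>

definition gram1 :: "(real \<Rightarrow> complex mat) \<Rightarrow> real \<Rightarrow> complex mat" where
  "gram1 p \<theta> = mat_adjoint (p \<theta>) * p \<theta> + mat_adjoint (p (\<theta> + pi)) * p (\<theta> + pi)"

definition s1 :: "(real \<Rightarrow> complex mat) \<Rightarrow> real \<Rightarrow> complex mat" where
  "s1 p \<theta> = p \<theta> * mat_inv (gram1 p \<theta>) * mat_adjoint (p \<theta>)"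

text \<open>
  Points of \<open>\<real>\<^sup>m\<close> are functions of which only the values at \<open>l < m\<close> matter; the elements of
  \<open>Omega m \<theta>\<close> are normalised outside that range, so that the set has exactly \<open>2\<^sup>m\<close> elements.
\<close>

definition Omega :: "nat \<Rightarrow> (nat \<Rightarrow> real) \<Rightarrow> (nat \<Rightarrow> real) set" where
  "Omega m \<theta> = (\<lambda>\<eta>. \<lambda>l\<in>{..<m}. \<theta> l + pi * \<eta> l) ` ({..<m} \<rightarrow>\<^sub>E {0, 1})"

definition p_multi :: "nat \<Rightarrow> (nat \<Rightarrow> real \<Rightarrow> complex mat) \<Rightarrow> (nat \<Rightarrow> real) \<Rightarrow> complex mat" where
  "p_multi m p \<theta> = big_kron m (\<lambda>l. p l (\<theta> l))"

definition sum_mats :: "nat \<Rightarrow> ('b \<Rightarrow> complex mat) \<Rightarrow> 'b set \<Rightarrow> complex mat" where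
  "sum_mats n M X = mat n n (\<lambda>(i, j). \<Sum>x\<in>X. M x $$ (i, j))"

definition s_multi ::
  "nat \<Rightarrow> (nat \<Rightarrow> nat) \<Rightarrow> (nat \<Rightarrow> real \<Rightarrow> complex mat) \<Rightarrow> (nat \<Rightarrow> real) \<Rightarrow> complex mat" where
  "s_multi m r p \<theta> =
     p_multi m p \<theta>
     * mat_inv (sum_mats (\<Prod>l<m. r l) (\<lambda>\<xi>. mat_adjoint (p_multi m p \<xi>) * p_multi m p \<xi>) (Omega m \<theta>))
     * mat_adjoint (p_multi m p \<theta>)"

end

theory Submission
  imports Defs
begin

text \<open>
  Everything factorises along the Kronecker product: by distributivity the sum over \<open>\<Omega>(\<theta>)\<close> of
  \<open>p\<^sup>H p\<close> is the Kronecker product of the univariate sums \<^const>\<open>gram1\<close>, and products, adjoints and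
  inverses are taken factor by factor. Hence \<open>s(\<theta>)\<close> is the Kronecker product of the univariate
  symbols \<^const>\<open>s1\<close>, and each factor fixes the corresponding factor of \<open>q\<close>.
\<close>

section \<open>Adjoints and inverses\<close>

lemma dim_mat_adjoint [simp]:
  "dim_row (mat_adjoint A) = dim_col A" "dim_col (mat_adjoint A) = dim_row A"
  by (simp_all add: mat_adjoint_def)

lemma mat_adjoint_carrier:
  "A \<in> carrier_mat n k \<Longrightarrow> mat_adjoint A \<in> carrier_mat k n"
  by (auto intro!: carrier_matI)

lemma index_mat_adjoint:
  "i < dim_col A \<Longrightarrow> j < dim_row A \<Longrightarrow> mat_adjoint A $$ (i, j) = conjugate (A $$ (j, i))"
  by (simp add: mat_adjoint_def mat_of_rows_def)

text \<open>For square matrices a right inverse is also a left inverse, so \<open>A\<close> is a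
  unit and \<open>mat_inverse A\<close> cannot be \<open>None\<close>. Its value \<open>C\<close> is
  then \<open>B\<close> by associativity: \<open>C = C (A B) = (C A) B = B\<close>.\<close>

lemma mat_inv_eqI:
  assumes A: "A \<in> carrier_mat n n" and B: "B \<in> carrier_mat n n" and AB: "A * B = 1\<^sub>m n"
  shows "mat_inv A = B"
proof (cases "mat_inverse A")
  case None
  have "B * A = 1\<^sub>m n" by (rule mat_mult_left_right_inverse[OF A B AB])
  then have "A \<in> Units (ring_mat TYPE(complex) n ())"
    using A B AB by (auto simp: Units_def ring_mat_def)
  with mat_inverse(1)[OF A None, of "()"] show ?thesis by simp
next
  case (Some C)
  from mat_inverse(2)[OF A Some] have C: "C * A = 1\<^sub>m n" "C \<in> carrier_mat n n" by auto
  have "C = C * (A * B)" using C AB by simp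
  also have "\<dots> = C * A * B" by (rule assoc_mult_mat[OF C(2) A B, symmetric])
  also have "\<dots> = B" unfolding C(1) using B by simp
  finally show ?thesis using Some by simp
qed

lemma mat_inv_correct:
  assumes A: "A \<in> carrier_mat n n" and "det A \<noteq> 0"
  shows "mat_inv A \<in> carrier_mat n n" "A * mat_inv A = 1\<^sub>m n"
proof -
  have "mat_inverse A \<noteq> None"
    using det_non_zero_imp_unit[OF assms, of "()"] mat_inverse(1)[OF A, of "()"] by blast
  then obtain B where B: "mat_inverse A = Some B" by blast
  show "mat_inv A \<in> carrier_mat n n" "A * mat_inv A = 1\<^sub>m n"
    using mat_inverse(2)[OF A B] B by auto
qed

text \<open>A singular matrix has a nonzero kernel vector, and there the quadratic form vanishes.
  This turns condition (i) into invertibility of the Gram matrices.\<close>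

lemma pos_definite_det_nonzero:
  assumes "pos_definite n A"
  shows "det A \<noteq> 0"
proof
  assume "det A = 0"
  have A: "A \<in> carrier_mat n n" using assms by (simp add: pos_definite_def hermitian_mat_def)
  obtain v where v: "v \<in> carrier_vec n" "v \<noteq> 0\<^sub>v n" "A *\<^sub>v v = 0\<^sub>v n"
    using det_0_iff_vec_prod_zero[OF A] \<open>det A = 0\<close> by blast
  then have "0 < Re ((A *\<^sub>v v) \<bullet>c v)" using assms unfolding pos_definite_def by blast
  with v show False by (simp add: scalar_prod_def)
qed


section \<open>Kronecker products\<close>

lemma div_mod_less_mult:
  fixes i a b :: nat
  assumes "i < a * b"
  shows "i div b < a" "i mod b < b"
proof -
  show "i div b < a" using assms by (simp add: less_mult_imp_div_less)
  show "i mod b < b" using assms by (cases "b = 0") auto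
qed

text \<open>\<open>k\<close> corresponds to the pair \<open>(k div b, k mod b)\<close>, which is
  exactly how \<open>kron\<close> encodes index pairs. Every contraction over a Kronecker index
  separates into two sums this way.\<close>

lemma sum_div_mod:
  fixes f g :: "nat \<Rightarrow> 'a :: comm_semiring_0"
  shows "(\<Sum>k = 0..<a * b. f (k div b) * g (k mod b)) = (\<Sum>i = 0..<a. f i) * (\<Sum>j = 0..<b. g j)"
proof -
  have "(\<Sum>i = 0..<a. f i) * (\<Sum>j = 0..<b. g j) = (\<Sum>(i, j)\<in>{0..<a} \<times> {0..<b}. f i * g j)"
    by (simp add: sum_product sum.cartesian_product)
  also have "\<dots> = (\<Sum>k = 0..<a * b. f (k div b) * g (k mod b))"
  proof (rule sum.reindex_bij_witness
      [where j = "\<lambda>(i, j). i * b + j" and i = "\<lambda>k. (k div b, k mod b)"])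
    fix x assume "x \<in> {0..<a} \<times> {0..<b}"
    then obtain i j where x: "x = (i, j)" "i < a" "j < b" by auto
    have "i * b + j < Suc i * b" using x by simp
    also have "\<dots> \<le> a * b" using x by (intro mult_le_mono1) simp
    finally show "(case x of (i, j) \<Rightarrow> i * b + j) \<in> {0..<a * b}" using x by simp
  qed (use div_mod_less_mult in auto)
  finally show ?thesis by simp
qed

lemma dim_kron [simp]:
  "dim_row (kron A B) = dim_row A * dim_row B" "dim_col (kron A B) = dim_col A * dim_col B"
  by (simp_all add: kron_def)

lemma kron_carrier:
  "A \<in> carrier_mat n k \<Longrightarrow> B \<in> carrier_mat n' k' \<Longrightarrow> kron A B \<in> carrier_mat (n * n') (k * k')"
  by (auto intro!: carrier_matI)

lemma index_kron:
  "i < dim_row A * dim_row B \<Longrightarrow> j < dim_col A * dim_col B \<Longrightarrow>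
     kron A B $$ (i, j) = A $$ (i div dim_row B, j div dim_col B) * B $$ (i mod dim_row B, j mod dim_col B)"
  by (simp add: kron_def)

text \<open>The mixed-product property. Once the scalars are regrouped, each summand is a function
  of the quotient of the inner index times a function of its remainder, so
  \<open>sum_div_mod\<close> applies.\<close>

lemma kron_mult:
  assumes "dim_col A = dim_row C" "dim_col B = dim_row D"
  shows "kron A B * kron C D = kron (A * C) (B * D)"
proof (rule eq_matI)
  fix i j
  assume "i < dim_row (kron (A * C) (B * D))" "j < dim_col (kron (A * C) (B * D))"
  then have i: "i < dim_row A * dim_row B" and j: "j < dim_col C * dim_col D" by simp_all
  have "(kron A B * kron C D) $$ (i, j)
      = (\<Sum>k = 0..<dim_row C * dim_row D. kron A B $$ (i, k) * kron C D $$ (k, j))"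
    using i j by (simp add: scalar_prod_def assms)
  also have "\<dots> = (\<Sum>k = 0..<dim_row C * dim_row D.
      (A $$ (i div dim_row B, k div dim_row D) * C $$ (k div dim_row D, j div dim_col D)) *
      (B $$ (i mod dim_row B, k mod dim_row D) * D $$ (k mod dim_row D, j mod dim_col D)))"
    using i j by (intro sum.cong refl) (simp add: index_kron assms)
  also have "\<dots> = (\<Sum>k = 0..<dim_row C. A $$ (i div dim_row B, k) * C $$ (k, j div dim_col D)) *
      (\<Sum>k = 0..<dim_row D. B $$ (i mod dim_row B, k) * D $$ (k, j mod dim_col D))"
    by (rule sum_div_mod)
  also have "\<dots> = (A * C) $$ (i div dim_row B, j div dim_col D)
      * (B * D) $$ (i mod dim_row B, j mod dim_col D)"
    using div_mod_less_mult[OF i] div_mod_less_mult[OF j] by (simp add: scalar_prod_def assms)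
  finally show "(kron A B * kron C D) $$ (i, j) = kron (A * C) (B * D) $$ (i, j)"
    using i j by (simp add: index_kron)
qed simp_all

lemma kron_mult_vec:
  assumes "dim_col A = dim_vec u" "dim_col B = dim_vec v"
  shows "kron A B *\<^sub>v kron_vec u v = kron_vec (A *\<^sub>v u) (B *\<^sub>v v)"
proof (rule eq_vecI)
  fix i
  assume "i < dim_vec (kron_vec (A *\<^sub>v u) (B *\<^sub>v v))"
  then have i: "i < dim_row A * dim_row B" by (simp add: kron_vec_def)
  have "(kron A B *\<^sub>v kron_vec u v) $ i
      = (\<Sum>k = 0..<dim_vec u * dim_vec v. kron A B $$ (i, k) * kron_vec u v $ k)"
    using i by (simp add: scalar_prod_def assms kron_vec_def)
  also have "\<dots> = (\<Sum>k = 0..<dim_vec u * dim_vec v.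
      (A $$ (i div dim_row B, k div dim_vec v) * u $ (k div dim_vec v)) *
      (B $$ (i mod dim_row B, k mod dim_vec v) * v $ (k mod dim_vec v)))"
    using i by (intro sum.cong refl) (simp add: index_kron kron_vec_def assms)
  also have "\<dots> = (\<Sum>k = 0..<dim_vec u. A $$ (i div dim_row B, k) * u $ k) *
      (\<Sum>k = 0..<dim_vec v. B $$ (i mod dim_row B, k) * v $ k)"
    by (rule sum_div_mod)
  also have "\<dots> = kron_vec (A *\<^sub>v u) (B *\<^sub>v v) $ i"
    using i div_mod_less_mult[OF i] by (simp add: kron_vec_def scalar_prod_def assms)
  finally show "(kron A B *\<^sub>v kron_vec u v) $ i = kron_vec (A *\<^sub>v u) (B *\<^sub>v v) $ i" .
qed (simp add: kron_vec_def)

text \<open>Conjugation is multiplicative on scalars, and transposition commutes with splitting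
  indices into quotient and remainder. Hence the factors keep their order, unlike in the adjoint of
  a matrix product.\<close>

lemma mat_adjoint_kron: "mat_adjoint (kron A B) = kron (mat_adjoint A) (mat_adjoint B)"
proof (rule eq_matI)
  fix i j
  assume "i < dim_row (kron (mat_adjoint A) (mat_adjoint B))"
    "j < dim_col (kron (mat_adjoint A) (mat_adjoint B))"
  then have i: "i < dim_col A * dim_col B" and j: "j < dim_row A * dim_row B" by simp_all
  show "mat_adjoint (kron A B) $$ (i, j) = kron (mat_adjoint A) (mat_adjoint B) $$ (i, j)"
    using i j div_mod_less_mult[OF i] div_mod_less_mult[OF j]
    by (simp add: index_mat_adjoint index_kron)
qed simp_all

lemma kron_one: "kron (1\<^sub>m a) (1\<^sub>m b) = 1\<^sub>m (a * b)"
proof (rule eq_matI)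
  fix i j
  assume "i < dim_row (1\<^sub>m (a * b) :: complex mat)" "j < dim_col (1\<^sub>m (a * b) :: complex mat)"
  then have i: "i < a * b" and j: "j < a * b" by simp_all
  \<comment> \<open>An index is determined by its quotient and remainder, so the product of the two
    Kronecker deltas is the delta of the combined indices.\<close>
  have "i = j \<longleftrightarrow> i div b = j div b \<and> i mod b = j mod b"
    by (metis div_mult_mod_eq)
  then show "kron (1\<^sub>m a) (1\<^sub>m b) $$ (i, j) = 1\<^sub>m (a * b) $$ (i, j)"
    using i j div_mod_less_mult[OF i] div_mod_less_mult[OF j] by (auto simp: index_kron)
qed simp_all


section \<open>Iterated Kronecker products\<close>

lemma big_kron_cong: "(\<And>l. l < m \<Longrightarrow> A l = B l) \<Longrightarrow> big_kron m A = big_kron m B"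
  by (induction m) auto

lemma big_kron_vec_cong: "(\<And>l. l < m \<Longrightarrow> u l = v l) \<Longrightarrow> big_kron_vec m u = big_kron_vec m v"
  by (induction m) auto

lemma big_kron_carrier:
  "(\<And>l. l < m \<Longrightarrow> A l \<in> carrier_mat (n l) (k l)) \<Longrightarrow>
     big_kron m A \<in> carrier_mat (\<Prod>l<m. n l) (\<Prod>l<m. k l)"
  by (induction m) (auto intro: kron_carrier)

lemma dim_big_kron:
  "dim_row (big_kron m A) = (\<Prod>l<m. dim_row (A l))"
  "dim_col (big_kron m A) = (\<Prod>l<m. dim_col (A l))"
  by (induction m) auto

lemma dim_big_kron_vec: "dim_vec (big_kron_vec m v) = (\<Prod>l<m. dim_vec (v l))"
  by (induction m) (auto simp: kron_vec_def)

lemma big_kron_mult: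
  "(\<And>l. l < m \<Longrightarrow> dim_col (A l) = dim_row (B l)) \<Longrightarrow>
     big_kron m A * big_kron m B = big_kron m (\<lambda>l. A l * B l)"
  by (induction m) (auto simp: kron_mult dim_big_kron)

lemma big_kron_mult_vec:
  assumes "\<And>l. l < m \<Longrightarrow> dim_col (A l) = dim_vec (v l)"
  shows "big_kron m A *\<^sub>v big_kron_vec m v = big_kron_vec m (\<lambda>l. A l *\<^sub>v v l)"
  using assms
proof (induction m)
  case 0
  show ?case by (rule eq_vecI) auto
next
  case (Suc m)
  then show ?case by (auto simp: kron_mult_vec dim_big_kron dim_big_kron_vec)
qed

lemma mat_adjoint_big_kron: "mat_adjoint (big_kron m A) = big_kron m (\<lambda>l. mat_adjoint (A l))"
proof (induction m)
  case 0
  show ?case by (rule eq_matI) (auto simp: index_mat_adjoint)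
qed (simp add: mat_adjoint_kron)

lemma big_kron_one: "big_kron m (\<lambda>l. 1\<^sub>m (n l)) = 1\<^sub>m (\<Prod>l<m. n l)"
  by (induction m) (auto simp: kron_one)

text \<open>By the mixed-product property the candidate multiplies with \<open>big_kron m A\<close>
  to a Kronecker product of identities. By \<open>mat_inv_eqI\<close> this one-sided check
  suffices.\<close>

lemma mat_inv_big_kron:
  assumes A: "\<And>l. l < m \<Longrightarrow> A l \<in> carrier_mat (n l) (n l)"
    and det: "\<And>l. l < m \<Longrightarrow> det (A l) \<noteq> 0"
  shows "mat_inv (big_kron m A) = big_kron m (\<lambda>l. mat_inv (A l))"
proof (rule mat_inv_eqI)
  note inv = mat_inv_correct[OF A det]
  show "big_kron m A \<in> carrier_mat (\<Prod>l<m. n l) (\<Prod>l<m. n l)"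
    using A by (rule big_kron_carrier)
  show "big_kron m (\<lambda>l. mat_inv (A l)) \<in> carrier_mat (\<Prod>l<m. n l) (\<Prod>l<m. n l)"
    using inv(1) by (rule big_kron_carrier)
  have "big_kron m A * big_kron m (\<lambda>l. mat_inv (A l)) = big_kron m (\<lambda>l. A l * mat_inv (A l))"
    using A inv(1) by (intro big_kron_mult) (metis carrier_matD)
  also have "\<dots> = big_kron m (\<lambda>l. 1\<^sub>m (n l))"
    using inv(2) by (rule big_kron_cong)
  also have "\<dots> = 1\<^sub>m (\<Prod>l<m. n l)" by (rule big_kron_one)
  finally show "big_kron m A * big_kron m (\<lambda>l. mat_inv (A l)) = 1\<^sub>m (\<Prod>l<m. n l)" .
qed

text \<open>The distributive law: expanding a product of \<open>m\<close> sums gives one term for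
  each choice function \<open>g\<close>, which picks the summand \<open>g l\<close> from factor
  \<open>l\<close>. The induction splits off the last factor.\<close>

lemma sum_mats_big_kron:
  fixes M :: "nat \<Rightarrow> 'b \<Rightarrow> complex mat"
  assumes "\<And>l x. l < m \<Longrightarrow> x \<in> X \<Longrightarrow> M l x \<in> carrier_mat (n l) (n l)"
  shows "sum_mats (\<Prod>l<m. n l) (\<lambda>g. big_kron m (\<lambda>l. M l (g l))) ({..<m} \<rightarrow>\<^sub>E X)
    = big_kron m (\<lambda>l. sum_mats (n l) (M l) X)"
  using assms
proof (induction m)
  case 0
  \<comment> \<open>There is exactly one extensional function on the empty set, so the sum has the
    single term \<open>1\<^sub>m 1\<close>, the empty Kronecker product.\<close>
  show ?case by (rule eq_matI) (auto simp: sum_mats_def)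
next
  case (Suc m)
  let ?N = "\<Prod>l<m. n l"
  let ?P = "{..<m} \<rightarrow>\<^sub>E X"
  let ?K = "\<lambda>g. big_kron m (\<lambda>l. M l (g l))"
  have K: "?K g \<in> carrier_mat ?N ?N" if "g \<in> ?P" for g
    using Suc.prems that by (intro big_kron_carrier) (auto simp: PiE_iff)
  have M: "M m x \<in> carrier_mat (n m) (n m)" if "x \<in> X" for x
    using Suc.prems that by simp
  \<comment> \<open>Changing \<open>g\<close> at \<open>m\<close> leaves the factors with index
    below \<open>m\<close> untouched.\<close>
  have upd: "big_kron (Suc m) (\<lambda>l. M l ((g(m := x)) l)) = kron (?K g) (M m x)" for g x
    by (simp cong: big_kron_cong)
  have PiE: "{..<Suc m} \<rightarrow>\<^sub>E X = (\<lambda>(x, g). g(m := x)) ` (X \<times> ?P)"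
    by (simp add: lessThan_Suc PiE_insert_eq)
  \<comment> \<open>\<open>g\<close> is extensional on \<open>{..<m}\<close>, so its value at
    \<open>m\<close> is fixed and both \<open>x\<close> and \<open>g\<close> can be recovered from
    \<open>g(m := x)\<close>. The sum over choice functions thus becomes a double sum.\<close>
  have inj: "inj_on (\<lambda>(x, g). g(m := x)) (X \<times> ?P)"
    by (rule inj_combinator) simp
  have entry: "(\<Sum>g\<in>{..<Suc m} \<rightarrow>\<^sub>E X. big_kron (Suc m) (\<lambda>l. M l (g l)) $$ (i, j))
      = (\<Sum>g\<in>?P. ?K g $$ (i div n m, j div n m)) * (\<Sum>x\<in>X. M m x $$ (i mod n m, j mod n m))"
    if ij: "i < ?N * n m" "j < ?N * n m" for i j
  proof -
    have "(\<Sum>g\<in>{..<Suc m} \<rightarrow>\<^sub>E X. big_kron (Suc m) (\<lambda>l. M l (g l)) $$ (i, j))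
        = (\<Sum>(x, g)\<in>X \<times> ?P. kron (?K g) (M m x) $$ (i, j))"
      unfolding PiE sum.reindex[OF inj] unfolding o_def case_prod_unfold by (simp only: upd)
    also have "\<dots> = (\<Sum>(x, g)\<in>X \<times> ?P.
        M m x $$ (i mod n m, j mod n m) * ?K g $$ (i div n m, j div n m))"
    proof (intro sum.cong refl, clarify)
      fix x g assume "x \<in> X" "g \<in> ?P"
      then show "kron (?K g) (M m x) $$ (i, j)
          = M m x $$ (i mod n m, j mod n m) * ?K g $$ (i div n m, j div n m)"
        using K[of g] M[of x] ij by (simp add: index_kron)
    qed
    finally show ?thesis
      by (simp add: sum_product sum.cartesian_product mult.commute)
  qed
  have "sum_mats (\<Prod>l<Suc m. n l) (\<lambda>g. big_kron (Suc m) (\<lambda>l. M l (g l))) ({..<Suc m} \<rightarrow>\<^sub>E X)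
      = kron (sum_mats ?N ?K ?P) (sum_mats (n m) (M m) X)" (is "?L = ?R")
  proof (rule eq_matI)
    fix i j assume "i < dim_row ?R" "j < dim_col ?R"
    then have ij: "i < ?N * n m" "j < ?N * n m" by (simp_all add: sum_mats_def)
    then show "?L $$ (i, j) = ?R $$ (i, j)"
      using entry[OF ij] div_mod_less_mult[OF ij(1)] div_mod_less_mult[OF ij(2)]
      \<comment> \<open>Unfolding \<open>big_kron (Suc m)\<close> here would destroy the left-hand
        side of \<open>entry\<close>.\<close>
      by (simp add: sum_mats_def index_kron del: big_kron.simps)
  qed (simp_all add: sum_mats_def)
  also have "sum_mats ?N ?K ?P = big_kron m (\<lambda>l. sum_mats (n l) (M l) X)"
    using Suc by simp
  finally show ?case by simp
qed


section \<open>Factorisation of the multivariate symbol\<close>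

text \<open>The two terms are indexed by the shifts \<eta> = 0 and \<eta> = 1, which gives the shape
  of a single factor in \<open>sum_mats_big_kron\<close>.\<close>

lemma gram1_conv_sum_mats:
  assumes "\<And>\<theta>. p \<theta> \<in> carrier_mat n n"
  shows "gram1 p \<theta>
    = sum_mats n (\<lambda>\<eta>. mat_adjoint (p (\<theta> + pi * \<eta>)) * p (\<theta> + pi * \<eta>)) {0, 1}"
proof (rule eq_matI)
  have [simp]: "dim_row (p t) = n" "dim_col (p t) = n" for t
    using assms[of t] by auto
  show "dim_row (gram1 p \<theta>)
    = dim_row (sum_mats n (\<lambda>\<eta>. mat_adjoint (p (\<theta> + pi * \<eta>)) * p (\<theta> + pi * \<eta>)) {0, 1})"
    "dim_col (gram1 p \<theta>)
    = dim_col (sum_mats n (\<lambda>\<eta>. mat_adjoint (p (\<theta> + pi * \<eta>)) * p (\<theta> + pi * \<eta>)) {0, 1})"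
    by (simp_all add: gram1_def sum_mats_def)
  show "gram1 p \<theta> $$ (i, j)
    = sum_mats n (\<lambda>\<eta>. mat_adjoint (p (\<theta> + pi * \<eta>)) * p (\<theta> + pi * \<eta>)) {0, 1} $$ (i, j)"
    if "i < dim_row (sum_mats n (\<lambda>\<eta>. mat_adjoint (p (\<theta> + pi * \<eta>)) * p (\<theta> + pi * \<eta>)) {0, 1})"
      "j < dim_col (sum_mats n (\<lambda>\<eta>. mat_adjoint (p (\<theta> + pi * \<eta>)) * p (\<theta> + pi * \<eta>)) {0, 1})"
    for i j
    using that by (simp add: gram1_def sum_mats_def)
qed

text \<open>Parametrised by the shift vector, each summand is a Kronecker product whose factor
  \<open>l\<close> depends on the shift in coordinate \<open>l\<close> alone. Distributivity
  therefore applies with the choice set \<open>{0, 1}\<close> in every coordinate.\<close>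

lemma sum_mats_Omega:
  assumes p: "\<And>l \<theta>. l < m \<Longrightarrow> p l \<theta> \<in> carrier_mat (r l) (r l)"
  shows "sum_mats (\<Prod>l<m. r l) (\<lambda>\<xi>. mat_adjoint (p_multi m p \<xi>) * p_multi m p \<xi>) (Omega m \<theta>)
    = big_kron m (\<lambda>l. gram1 (p l) (\<theta> l))"
proof -
  let ?M = "\<lambda>l \<eta>. mat_adjoint (p l (\<theta> l + pi * \<eta>)) * p l (\<theta> l + pi * \<eta>)"
  let ?sh = "\<lambda>\<eta>. \<lambda>l\<in>{..<m}. \<theta> l + pi * \<eta> l"
  \<comment> \<open>Distinct shift vectors must give distinct points, or terms would be lost in
    summing over the image. This holds because \<pi> is nonzero and shift vectors are
    extensional.\<close>
  have inj: "inj_on ?sh ({..<m} \<rightarrow>\<^sub>E {0, 1})"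
  proof (rule inj_onI)
    fix g h assume g: "g \<in> {..<m} \<rightarrow>\<^sub>E {0, 1}" and h: "h \<in> {..<m} \<rightarrow>\<^sub>E {0, 1}" and "?sh g = ?sh h"
    then have "?sh g l = ?sh h l" for l by simp
    then have "g l = h l" if "l < m" for l
      using that by (metis (mono_tags, lifting) add_left_cancel lessThan_iff mult_left_cancel
          pi_neq_zero restrict_apply')
    then show "g = h" using g h by (intro PiE_ext[OF g h]) simp
  qed
  have summand: "mat_adjoint (p_multi m p (?sh g)) * p_multi m p (?sh g)
      = big_kron m (\<lambda>l. ?M l (g l))" for g
  proof -
    have "p_multi m p (?sh g) = big_kron m (\<lambda>l. p l (\<theta> l + pi * g l))"
      unfolding p_multi_def by (rule big_kron_cong) simp
    then show ?thesis
      using p by (simp add: mat_adjoint_big_kron big_kron_mult)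
  qed
  have "sum_mats (\<Prod>l<m. r l) (\<lambda>\<xi>. mat_adjoint (p_multi m p \<xi>) * p_multi m p \<xi>) (Omega m \<theta>)
      = sum_mats (\<Prod>l<m. r l) (\<lambda>g. big_kron m (\<lambda>l. ?M l (g l))) ({..<m} \<rightarrow>\<^sub>E {0, 1})"
    unfolding sum_mats_def Omega_def sum.reindex[OF inj] by (simp add: summand)
  also have "\<dots> = big_kron m (\<lambda>l. sum_mats (r l) (?M l) {0, 1})"
    using p by (intro sum_mats_big_kron mult_carrier_mat mat_adjoint_carrier)
  also have "\<dots> = big_kron m (\<lambda>l. gram1 (p l) (\<theta> l))"
    by (rule big_kron_cong, rule gram1_conv_sum_mats[symmetric], rule p)
  finally show ?thesis .
qed

text \<open>All three matrices in the product defining \<open>s_multi\<close> are Kronecker products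
  over the same index range, so two uses of the mixed-product property gather the factors of each
  \<open>s1\<close>.\<close>

lemma s_multi_conv_big_kron:
  assumes p: "\<And>l \<theta>. l < m \<Longrightarrow> p l \<theta> \<in> carrier_mat (r l) (r l)"
    and det: "\<And>l. l < m \<Longrightarrow> det (gram1 (p l) (\<theta> l)) \<noteq> 0"
  shows "s_multi m r p \<theta> = big_kron m (\<lambda>l. s1 (p l) (\<theta> l))"
proof -
  have G: "gram1 (p l) t \<in> carrier_mat (r l) (r l)" if "l < m" for l t
    using p[OF that] unfolding gram1_def
    by (intro add_carrier_mat mult_carrier_mat mat_adjoint_carrier)
  \<comment> \<open>The dimensions of \<open>mat_inv\<close> are known only when the inverse exists;
    the mixed-product property needs them to match.\<close>
  have "mat_inv (gram1 (p l) (\<theta> l)) \<in> carrier_mat (r l) (r l)" if "l < m" for l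
    using that by (intro mat_inv_correct(1) G det)
  then have dims: "dim_row (mat_inv (gram1 (p l) (\<theta> l))) = r l"
    "dim_col (mat_inv (gram1 (p l) (\<theta> l))) = r l"
    "dim_row (p l (\<theta> l)) = r l" "dim_col (p l (\<theta> l)) = r l" if "l < m" for l
    using that p by blast+
  have "mat_inv (sum_mats (\<Prod>l<m. r l)
        (\<lambda>\<xi>. mat_adjoint (p_multi m p \<xi>) * p_multi m p \<xi>) (Omega m \<theta>))
      = mat_inv (big_kron m (\<lambda>l. gram1 (p l) (\<theta> l)))"
    using p by (simp only: sum_mats_Omega)
  also have "\<dots> = big_kron m (\<lambda>l. mat_inv (gram1 (p l) (\<theta> l)))"
    using G det by (rule mat_inv_big_kron)
  finally show ?thesis
    unfolding s_multi_def
    by (simp add: p_multi_def mat_adjoint_big_kron s1_def big_kron_mult dims)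
qed

section \<open>From the factors to the fixed vector of the multivariate symbol\<close>

lemma trig_poly_mat_carrier: "trig_poly_mat r F \<Longrightarrow> F \<theta> \<in> carrier_mat r r"
  by (auto simp: trig_poly_mat_def)

theorem lemma6p4:
  fixes m :: nat
    and r :: "nat \<Rightarrow> nat"
    and f p :: "nat \<Rightarrow> real \<Rightarrow> complex mat"
    and \<theta>\<^sub>0 :: "nat \<Rightarrow> real"
    and q :: "nat \<Rightarrow> complex vec"
    and jbar :: "nat \<Rightarrow> nat"
    and lam :: "nat \<Rightarrow> nat \<Rightarrow> real \<Rightarrow> real"
    and \<mu> :: "nat \<Rightarrow> real \<Rightarrow> real"
    and c :: "nat \<Rightarrow> real"
  assumes m: "1 \<le> m"
    and f_trig: "\<And>l. l < m \<Longrightarrow> trig_poly_mat (r l) (f l)"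
    and f_nonneg: "\<And>l \<theta>. l < m \<Longrightarrow> nonneg_definite (r l) (f l \<theta>)"
    and f_eigenvalues: "\<And>l. l < m \<Longrightarrow> eigenvalue_functions (r l) (f l) (lam l)"
    and jbar: "\<And>l. l < m \<Longrightarrow> jbar l < r l"
    and \<theta>\<^sub>0: "\<And>l. l < m \<Longrightarrow> \<theta>\<^sub>0 l \<in> {0..<2 * pi}"
    and f_zero: "\<And>l. l < m \<Longrightarrow> lam l (jbar l) (\<theta>\<^sub>0 l) = 0"
    and f_pos: "\<And>l j \<theta>. l < m \<Longrightarrow> j < r l \<Longrightarrow> \<theta> \<in> {0..<2 * pi} \<Longrightarrow>
                  (j, \<theta>) \<noteq> (jbar l, \<theta>\<^sub>0 l) \<Longrightarrow> 0 < lam l j \<theta>"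
    and p_trig: "\<And>l. l < m \<Longrightarrow> trig_poly_mat (r l) (p l)"
    and q_eigenvector: "\<And>l. l < m \<Longrightarrow> eigenvector (f l (\<theta>\<^sub>0 l)) (q l) 0"
    and cond_i: "\<And>l \<theta>. l < m \<Longrightarrow> \<theta> \<in> {0..<2 * pi} \<Longrightarrow> pos_definite (r l) (gram1 (p l) \<theta>)"
    and cond_ii: "\<And>l. l < m \<Longrightarrow> s1 (p l) (\<theta>\<^sub>0 l) *\<^sub>v q l = q l"
    and s_eigenvalue: "\<And>l. l < m \<Longrightarrow>
                  eigenvalue_function_towards (r l) (s1 (p l)) (\<theta>\<^sub>0 l) (q l) (\<mu> l)"
    and cond_iii: "\<And>l. l < m \<Longrightarrow>
                  ((\<lambda>\<theta>. inverse (lam l (jbar l) \<theta>) * (1 - \<mu> l \<theta>)) \<longlongrightarrow> c l) (at (\<theta>\<^sub>0 l))"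
  shows "s_multi m r p \<theta>\<^sub>0 *\<^sub>v big_kron_vec m q = big_kron_vec m q"
proof -
  have p: "p l \<theta> \<in> carrier_mat (r l) (r l)" if "l < m" for l \<theta>
    using p_trig[OF that] by (rule trig_poly_mat_carrier)
  have det: "det (gram1 (p l) (\<theta>\<^sub>0 l)) \<noteq> 0" if "l < m" for l
    using cond_i[OF that \<theta>\<^sub>0[OF that]] by (rule pos_definite_det_nonzero)
  \<comment> \<open>The length of \<open>q l\<close> comes from its being an eigenvector of the
    square matrix \<open>f l (\<theta>\<^sub>0 l)\<close>, which has the same size as
    \<open>p l (\<theta>\<^sub>0 l)\<close>.\<close>
  have dim: "dim_col (s1 (p l) (\<theta>\<^sub>0 l)) = dim_vec (q l)" if "l < m" for l
    using q_eigenvector[OF that] carrier_matD[OF p[OF that]]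
      trig_poly_mat_carrier[OF f_trig[OF that], of "\<theta>\<^sub>0 l"]
    by (auto simp: s1_def eigenvector_def)
  have "s_multi m r p \<theta>\<^sub>0 *\<^sub>v big_kron_vec m q = big_kron_vec m (\<lambda>l. s1 (p l) (\<theta>\<^sub>0 l) *\<^sub>v q l)"
    by (simp add: s_multi_conv_big_kron[where p = p, OF p det] big_kron_mult_vec dim)
  \<comment> \<open>Condition (ii) is applied in each factor separately.\<close>
  also have "\<dots> = big_kron_vec m q"
    using cond_ii by (rule big_kron_vec_cong)
  finally show ?thesis .
qed

end
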